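(* Let $v$ be the number of secret bit variables $a_1,\dots,a_v$ and let $t(v)\in[v,v^2/2]$ be an integer. The ANDs $a_i\wedge a_j$ of any $t(v)$ prescribed pairs of variables can be computed by three parties (KH, EVH and one helper), with pre-shared keys and perfect security against each single party, with at most $4v+t(v)$ transmitted bits in total, i.e. with at most $1+4\cdot v/t(v)$ transmitted bits per computed pair.
   Context: For bits $m,K\in\{0,1\}$: $ENC_K(m):=K\oplus m$ (XOR). Model: three semi-honest parties, a key holder (KH), an encrypted value holder (EVH) and a helper, communicate over perfectly secure channels. Initially, for each variable $a_i$, the EVH holds $ENC_{K_i}(a_i)$ and the KH holds $K_i$, with $K_i$ a uniformly random bit; this initial distribution by the client is not counted as communication. Pairs of parties have pre-shared randomness: keys (independent uniformly random bits) known to two of the parties do not have to be transmitted and are not counted; in particular, the keys $K_i$ may be pre-shared between the KH and the helper. All other bits sent between parties are counted. Computing $a_i\wedge a_j$ means that at the end the EVH holds a bit $c_{ij}$ and the KH holds a bit $k_{ij}$ with $c_{ij}\oplus k_{ij}=a_i\wedge a_j$. Perfect security against each single party means that for each of the three parties, the joint distribution of everything it holds and receives does not depend on $(a_1,\dots,a_v)$. *)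

theory Defs
  imports "HOL-Probability.Probability"
begin

definition bxor :: "bool \<Rightarrow> bool \<Rightarrow> bool" (infixl "\<oplus>" 65) where
  "x \<oplus> y \<longleftrightarrow> x \<noteq> y"

definition ENC :: "bool \<Rightarrow> bool \<Rightarrow> bool" where
  "ENC K m = K \<oplus> m"

datatype party = KH | EVH | Helper

text \<open>
  Everything a party holds initially and has received so far. The bits a party sends or outputs
  are functions of its view, so they need not be recorded.
\<close>

record view =
  ciphertexts :: "nat \<rightharpoonup> bool"
  initial_keys :: "nat \<rightharpoonup> bool"
  preshared :: "nat \<rightharpoonup> bool"
  received :: "bool list"

text \<open>A transmission of a single bit, computed by the sender from its current view.\<close>

record message =
  sender :: party
  receiver :: party
  content :: "view \<Rightarrow> bool"

text \<open>
  The schedule of transmissions is fixed in advance, so neither the number of transmitted bits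
  nor the identity of the sender of a received bit carries information.
  Besides the initial keys \<open>K i\<close>, of which those with \<open>i \<in> helper_keys\<close> are pre-shared between the
  key holder and the helper, there are \<open>num_keys\<close> further pre-shared keys; the \<open>l\<close>-th one is
  known to exactly the parties in \<open>key_holders l\<close>.
\<close>

record protocol =
  helper_keys :: "nat set"
  num_keys :: nat
  key_holders :: "nat \<Rightarrow> party set"
  messages :: "message list"
  EVH_output :: "view \<Rightarrow> nat \<times> nat \<Rightarrow> bool"
  KH_output :: "view \<Rightarrow> nat \<times> nat \<Rightarrow> bool"

definition valid_protocol :: "protocol \<Rightarrow> bool" where
  "valid_protocol \<pi> \<longleftrightarrow>
     (\<forall>l<num_keys \<pi>. card (key_holders \<pi> l) = 2) \<and>
     (\<forall>m\<in>set (messages \<pi>). sender m \<noteq> receiver m)"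

text \<open>
  In the following, \<open>v\<close> is the number of variables, \<open>a\<close> their values, \<open>K\<close> the initial keys and
  \<open>R\<close> the further pre-shared keys; variables are indexed by \<open>0, \<dots>, v - 1\<close>.
\<close>

definition initial_view ::
  "nat \<Rightarrow> protocol \<Rightarrow> (nat \<Rightarrow> bool) \<Rightarrow> (nat \<Rightarrow> bool) \<Rightarrow> (nat \<Rightarrow> bool) \<Rightarrow> party \<Rightarrow> view" where
  "initial_view v \<pi> a K R p =
     \<lparr> ciphertexts = (\<lambda>i. if i < v \<and> p = EVH then Some (ENC (K i) (a i)) else None),
       initial_keys = (\<lambda>i. if i < v \<and> (p = KH \<or> p = Helper \<and> i \<in> helper_keys \<pi>)
                           then Some (K i) else None),
       preshared = (\<lambda>l. if l < num_keys \<pi> \<and> p \<in> key_holders \<pi> l then Some (R l) else None),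
       received = [] \<rparr>"

definition transmit :: "message \<Rightarrow> (party \<Rightarrow> view) \<Rightarrow> party \<Rightarrow> view" where
  "transmit m V =
     V(receiver m := (V (receiver m))
         \<lparr> received := received (V (receiver m)) @ [content m (V (sender m))] \<rparr>)"

definition final_view ::
  "nat \<Rightarrow> protocol \<Rightarrow> (nat \<Rightarrow> bool) \<Rightarrow> (nat \<Rightarrow> bool) \<Rightarrow> (nat \<Rightarrow> bool) \<Rightarrow> party \<Rightarrow> view" where
  "final_view v \<pi> a K R = fold transmit (messages \<pi>) (initial_view v \<pi> a K R)"

definition transmitted_bits :: "protocol \<Rightarrow> nat" where
  "transmitted_bits \<pi> = length (messages \<pi>)"

text \<open>
  Correctness is perfect: it is required for every outcome of the keys. Values of \<open>a\<close>, \<open>K\<close>, \<open>R\<close>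
  outside the relevant index ranges never enter any view.
\<close>

definition computes_ands :: "nat \<Rightarrow> (nat \<times> nat) set \<Rightarrow> protocol \<Rightarrow> bool" where
  "computes_ands v P \<pi> \<longleftrightarrow>
     (\<forall>a K R. \<forall>(i, j)\<in>P.
        EVH_output \<pi> (final_view v \<pi> a K R EVH) (i, j) \<oplus>
        KH_output \<pi> (final_view v \<pi> a K R KH) (i, j) \<longleftrightarrow> a i \<and> a j)"

definition uniform_bits :: "nat \<Rightarrow> (nat \<Rightarrow> bool) pmf" where
  "uniform_bits n = Pi_pmf {..<n} False (\<lambda>_. pmf_of_set UNIV)"

definition view_distribution :: "nat \<Rightarrow> protocol \<Rightarrow> (nat \<Rightarrow> bool) \<Rightarrow> party \<Rightarrow> view pmf" where
  "view_distribution v \<pi> a p =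
     map_pmf (\<lambda>(K, R). final_view v \<pi> a K R p)
       (pair_pmf (uniform_bits v) (uniform_bits (num_keys \<pi>)))"

definition perfectly_secure :: "nat \<Rightarrow> protocol \<Rightarrow> bool" where
  "perfectly_secure v \<pi> \<longleftrightarrow>
     (\<forall>p a a'. view_distribution v \<pi> a p = view_distribution v \<pi> a' p)"

end

theory Submission
  imports Defs
begin

text \<open>
  Write \<open>e i = K i \<oplus> a i\<close> for the ciphertexts. In
  \<open>a i \<and> a j = e i e j \<oplus> (e i K j \<oplus> e j K i) \<oplus> K i K j\<close>
  only the middle term mixes data of the two holders. The EVH masks \<open>e i\<close> by a bit \<open>s i\<close>
  pre-shared with the helper and sends \<open>e i \<oplus> s i\<close> to the KH, which costs \<open>v\<close> bits. The KH can
  then form \<open>(e i \<oplus> s i) K j \<oplus> (e j \<oplus> s j) K i\<close>, and the error \<open>s i K j \<oplus> s j K i\<close> is known to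
  the helper, who sends it to the EVH masked by a fresh bit pre-shared with the KH, one bit per
  pair. Hence already \<open>v + t\<close> bits suffice. Security holds because, for each party, a change of
  the values \<open>a\<close> is compensated by an involution of the space of keys.
\<close>

text \<open>As \<open>p \<noteq> q\<close>, a one-way batch never alters the view of the sender, so
  every content can be evaluated before the batch.\<close>

lemma fold_transmit_one_way:
  assumes "p \<noteq> q" and "\<forall>m\<in>set ms. sender m = p \<and> receiver m = q"
  shows "fold transmit ms V =
    V(q := (V q)\<lparr>received := received (V q) @ map (\<lambda>m. content m (V p)) ms\<rparr>)"
  using assms(2)
proof (induction ms arbitrary: V)
  case Nil
  then show ?case by simp
next
  case (Cons m ms)
  have ms: "\<forall>m\<in>set ms. sender m = p \<and> receiver m = q"
    and m: "sender m = p" "receiver m = q"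
    using Cons.prems by auto
  have "transmit m V = V(q := (V q)\<lparr>received := received (V q) @ [content m (V p)]\<rparr>)"
    by (simp only: transmit_def m)
  then show ?case
    using assms(1) by (auto simp: Cons.IH[OF ms])
qed

section \<open>The protocol, its cost and its final views\<close>

text \<open>
  The pre-shared keys with index \<open>i < v\<close> are the masks \<open>s i\<close>, and the key with index \<open>v + n\<close> masks
  the bit sent for the \<open>n\<close>-th pair \<open>pr n\<close>; \<open>idx\<close> is the inverse of \<open>pr\<close>.
\<close>

definition masked_ciphertext :: "nat \<Rightarrow> message" where
  "masked_ciphertext i = \<lparr>sender = EVH, receiver = KH,
     content = (\<lambda>w. the (ciphertexts w i) \<oplus> the (preshared w i))\<rparr>"

definition masked_correction :: "nat \<Rightarrow> (nat \<Rightarrow> nat \<times> nat) \<Rightarrow> nat \<Rightarrow> message" where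
  "masked_correction v pr n = \<lparr>sender = Helper, receiver = EVH,
     content = (\<lambda>w. case pr n of (i, j) \<Rightarrow>
       (the (preshared w i) \<and> the (initial_keys w j)) \<oplus>
       (the (preshared w j) \<and> the (initial_keys w i)) \<oplus> the (preshared w (v + n)))\<rparr>"

text \<open>KH receives only masked ciphertexts and EVH only corrections, each in index order; hence
  the positions \<open>i\<close> and \<open>idx (i, j)\<close> in \<open>received\<close>.\<close>

definition and_protocol ::
  "nat \<Rightarrow> nat \<Rightarrow> (nat \<Rightarrow> nat \<times> nat) \<Rightarrow> (nat \<times> nat \<Rightarrow> nat) \<Rightarrow> protocol" where
  "and_protocol v t pr idx =
    \<lparr>helper_keys = UNIV,
     num_keys = v + t,
     key_holders = (\<lambda>l. if l < v then {EVH, Helper} else {KH, Helper}),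
     messages = map masked_ciphertext [0..<v] @ map (masked_correction v pr) [0..<t],
     EVH_output = (\<lambda>w (i, j).
       (the (ciphertexts w i) \<and> the (ciphertexts w j)) \<oplus> received w ! idx (i, j)),
     KH_output = (\<lambda>w (i, j).
       (the (initial_keys w i) \<and> the (initial_keys w j)) \<oplus>
       (received w ! i \<and> the (initial_keys w j)) \<oplus>
       (received w ! j \<and> the (initial_keys w i)) \<oplus> the (preshared w (v + idx (i, j))))\<rparr>"

lemma valid_and_protocol: "valid_protocol (and_protocol v t pr idx)"
  by (auto simp: valid_protocol_def and_protocol_def masked_ciphertext_def masked_correction_def)

lemma transmitted_bits_and_protocol: "transmitted_bits (and_protocol v t pr idx) = v + t"
  by (simp add: transmitted_bits_def and_protocol_def)

lemma final_view_and_protocol: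
  fixes v t pr idx a K R
  defines "\<pi> \<equiv> and_protocol v t pr idx"
  defines "V \<equiv> initial_view v \<pi> a K R"
  assumes pr: "pr ` {..<t} \<subseteq> {..<v} \<times> {..<v}"
  shows "final_view v \<pi> a K R KH =
           (V KH)\<lparr>received := map (\<lambda>i. ENC (K i) (a i) \<oplus> R i) [0..<v]\<rparr>"
    and "final_view v \<pi> a K R EVH =
           (V EVH)\<lparr>received := map (\<lambda>n. case pr n of (i, j) \<Rightarrow>
              (R i \<and> K j) \<oplus> (R j \<and> K i) \<oplus> R (v + n)) [0..<t]\<rparr>"
    and "final_view v \<pi> a K R Helper = V Helper"
proof -
  let ?ms = "map masked_ciphertext [0..<v]" and ?ns = "map (masked_correction v pr) [0..<t]"
  have "final_view v \<pi> a K R = fold transmit ?ns (fold transmit ?ms V)"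
    by (simp add: final_view_def V_def \<pi>_def and_protocol_def)
  also have "fold transmit ?ms V =
      V(KH := (V KH)\<lparr>received := received (V KH) @ map (\<lambda>m. content m (V EVH)) ?ms\<rparr>)"
    by (rule fold_transmit_one_way) (auto simp: masked_ciphertext_def)
  also have "map (\<lambda>m. content m (V EVH)) ?ms = map (\<lambda>i. ENC (K i) (a i) \<oplus> R i) [0..<v]"
    by (auto simp: masked_ciphertext_def V_def initial_view_def \<pi>_def and_protocol_def)
  finally have 1: "final_view v \<pi> a K R = fold transmit ?ns
      (V(KH := (V KH)\<lparr>received := received (V KH) @ map (\<lambda>i. ENC (K i) (a i) \<oplus> R i) [0..<v]\<rparr>))"
    (is "_ = fold transmit ?ns ?W") .
  have 2: "fold transmit ?ns ?W = ?W(EVH := (?W EVH)\<lparr>received := received (?W EVH) @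
      map (\<lambda>m. content m (?W Helper)) ?ns\<rparr>)"
    by (rule fold_transmit_one_way) (auto simp: masked_correction_def)
  \<comment> \<open>Both indices in \<open>pr n\<close> lie below \<open>v\<close>, so each
    \<open>the\<close> is applied to a \<open>Some\<close>.\<close>
  have "content (masked_correction v pr n) (V Helper) =
      (case pr n of (i, j) \<Rightarrow> (R i \<and> K j) \<oplus> (R j \<and> K i) \<oplus> R (v + n))" if "n < t" for n
    proof -
    have "fst (pr n) < v" "snd (pr n) < v"
      using pr that by (auto simp: image_subset_iff mem_Times_iff)
    with that show ?thesis
      by (simp add: masked_correction_def V_def initial_view_def \<pi>_def and_protocol_def split_beta)
  qed
  then have 3: "map (\<lambda>m. content m (?W Helper)) ?ns = map (\<lambda>n. case pr n of (i, j) \<Rightarrow>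
      (R i \<and> K j) \<oplus> (R j \<and> K i) \<oplus> R (v + n)) [0..<t]"
    by simp
  have "received (V q) = []" for q
    by (simp add: V_def initial_view_def)
  then show "final_view v \<pi> a K R KH =
           (V KH)\<lparr>received := map (\<lambda>i. ENC (K i) (a i) \<oplus> R i) [0..<v]\<rparr>"
    and "final_view v \<pi> a K R EVH =
           (V EVH)\<lparr>received := map (\<lambda>n. case pr n of (i, j) \<Rightarrow>
              (R i \<and> K j) \<oplus> (R j \<and> K i) \<oplus> R (v + n)) [0..<t]\<rparr>"
    and "final_view v \<pi> a K R Helper = V Helper"
    unfolding 1 2 3 by simp_all
qed

section \<open>Correctness of the outputs\<close>

lemma computes_ands_and_protocol:
  assumes pr: "pr ` {..<t} \<subseteq> {..<v} \<times> {..<v}"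
    and idx: "\<And>p. p \<in> P \<Longrightarrow> idx p < t \<and> pr (idx p) = p"
  shows "computes_ands v P (and_protocol v t pr idx)"
  unfolding computes_ands_def
proof (intro allI ballI, clarify)
  fix a K R i j
  assume P: "(i, j) \<in> P"
  have n: "idx (i, j) < t" "pr (idx (i, j)) = (i, j)"
    using idx[OF P] by auto
  then have ij: "i < v" "j < v"
    using pr by (metis SigmaD1 SigmaD2 image_subset_iff lessThan_iff)+
  show "EVH_output (and_protocol v t pr idx)
          (final_view v (and_protocol v t pr idx) a K R EVH) (i, j) \<oplus>
        KH_output (and_protocol v t pr idx)
          (final_view v (and_protocol v t pr idx) a K R KH) (i, j) \<longleftrightarrow> a i \<and> a j"
    unfolding final_view_and_protocol[OF pr]
    \<comment> \<open>The pair key and the products of \<open>R\<close> with \<open>K\<close> occur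
      in both outputs and cancel; the rest is
      \<open>(e i \<oplus> K i) \<and> (e j \<oplus> K j)\<close> expanded.\<close>
    by (cases "K i"; cases "K j"; cases "a i"; cases "a j"; cases "R i"; cases "R j")
      (simp_all add: n ij and_protocol_def initial_view_def ENC_def bxor_def)
qed

section \<open>Security via involutions of the key space\<close>

text \<open>The keys are uniform on a finite set of functions that are \<open>False\<close> beyond
  their range. Fixing those coordinates, \<open>\<phi>\<close> maps this set into itself, and being
  its own inverse it permutes it.\<close>

lemma map_uniform_bits_involution:
  fixes \<phi> :: "(nat \<Rightarrow> bool) \<times> (nat \<Rightarrow> bool) \<Rightarrow> (nat \<Rightarrow> bool) \<times> (nat \<Rightarrow> bool)"
  assumes inv: "\<And>x. \<phi> (\<phi> x) = x"
    and supp: "\<And>K R i. m \<le> i \<Longrightarrow> fst (\<phi> (K, R)) i = K i"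
      "\<And>K R i. n \<le> i \<Longrightarrow> snd (\<phi> (K, R)) i = R i"
  shows "map_pmf \<phi> (pair_pmf (uniform_bits m) (uniform_bits n)) =
         pair_pmf (uniform_bits m) (uniform_bits n)"
proof -
  define A :: "nat \<Rightarrow> (nat \<Rightarrow> bool) set" where "A k = PiE_dflt {..<k} False (\<lambda>_. UNIV)" for k
  have A: "f \<in> A k \<longleftrightarrow> (\<forall>i\<ge>k. \<not> f i)" for f k
    by (auto simp: A_def PiE_dflt_def not_less)
  have fin: "finite (A k)" for k
    unfolding A_def by (intro finite_PiE_dflt) auto
  have ne: "A k \<noteq> {}" for k
    using A[of "\<lambda>_. False" k] by auto
  have unif: "uniform_bits k = pmf_of_set (A k)" for k
    unfolding uniform_bits_def A_def by (intro Pi_pmf_of_set) auto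
  have pair: "pair_pmf (uniform_bits m) (uniform_bits n) = pmf_of_set (A m \<times> A n)"
    unfolding unif using fin ne
    by (intro pmf_eqI) (auto simp: pmf_pair card_cartesian_product indicator_def)
  have "\<phi> (K, R) \<in> A m \<times> A n" if "K \<in> A m" "R \<in> A n" for K R
    using that by (simp add: mem_Times_iff A supp)
  then have sub: "\<phi> ` (A m \<times> A n) \<subseteq> A m \<times> A n"
    by blast
  have "bij_betw \<phi> (A m \<times> A n) (A m \<times> A n)"
    using inv sub by (intro bij_betw_byWitness[where f' = \<phi>]) auto
  then show ?thesis
    unfolding pair using fin ne by (intro map_pmf_of_set_bij_betw) auto
qed

text \<open>Reduces security to a pointwise claim: \<open>\<phi>\<close> turns each run on
  \<open>a\<close> into a run on \<open>a'\<close> that looks the same to \<open>p\<close>.\<close>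

lemma view_distribution_eqI:
  fixes \<phi> :: "(nat \<Rightarrow> bool) \<times> (nat \<Rightarrow> bool) \<Rightarrow> (nat \<Rightarrow> bool) \<times> (nat \<Rightarrow> bool)"
  assumes inv: "\<And>x. \<phi> (\<phi> x) = x"
    and supp: "\<And>K R i. v \<le> i \<Longrightarrow> fst (\<phi> (K, R)) i = K i"
      "\<And>K R l. num_keys \<pi> \<le> l \<Longrightarrow> snd (\<phi> (K, R)) l = R l"
    and view: "\<And>K R. final_view v \<pi> a K R p =
       final_view v \<pi> a' (fst (\<phi> (K, R))) (snd (\<phi> (K, R))) p"
  shows "view_distribution v \<pi> a p = view_distribution v \<pi> a' p"
proof -
  let ?U = "pair_pmf (uniform_bits v) (uniform_bits (num_keys \<pi>))"
  let ?f = "\<lambda>a (K, R). final_view v \<pi> a K R p"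
  have "?f a = ?f a' \<circ> \<phi>"
  proof
    fix x
    show "?f a x = (?f a' \<circ> \<phi>) x"
      using view[of "fst x" "snd x"] by (simp add: split_beta)
  qed
  then have "view_distribution v \<pi> a p = map_pmf (?f a') (map_pmf \<phi> ?U)"
    by (simp only: view_distribution_def pmf.map_comp)
  also have "map_pmf \<phi> ?U = ?U"
    by (rule map_uniform_bits_involution[OF inv supp])
  finally show ?thesis
    by (simp only: view_distribution_def)
qed

lemma perfectly_secure_and_protocol:
  assumes pr: "pr ` {..<t} \<subseteq> {..<v} \<times> {..<v}"
  shows "perfectly_secure v (and_protocol v t pr idx)"
  unfolding perfectly_secure_def
proof (intro allI)
  fix p :: party and a a' :: "nat \<Rightarrow> bool"
  let ?\<pi> = "and_protocol v t pr idx"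
  \<comment> \<open>The cutoff at \<open>v\<close> keeps shifts by \<open>d\<close> within the key
    range.\<close>
  define d where "d i \<longleftrightarrow> i < v \<and> a i \<noteq> a' i" for i
  have num: "num_keys ?\<pi> = v + t"
    by (simp add: and_protocol_def)
  show "view_distribution v ?\<pi> a p = view_distribution v ?\<pi> a' p"
  proof (cases p)
    case KH
    \<comment> \<open>The masks below \<open>v\<close>, unknown to KH, absorb the change of the
      ciphertexts; the keys KH holds stay fixed.\<close>
    define \<phi> :: "(nat \<Rightarrow> bool) \<times> (nat \<Rightarrow> bool) \<Rightarrow> (nat \<Rightarrow> bool) \<times> (nat \<Rightarrow> bool)"
      where "\<phi> = (\<lambda>(K, R). (K, \<lambda>l. R l \<oplus> d l))"
    have "initial_view v ?\<pi> a K R KH =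
        initial_view v ?\<pi> a' (fst (\<phi> (K, R))) (snd (\<phi> (K, R))) KH" for K R
      by (simp add: \<phi>_def d_def bxor_def initial_view_def and_protocol_def fun_eq_iff)
    moreover have "ENC (K i) (a i) \<oplus> R i =
        ENC (fst (\<phi> (K, R)) i) (a' i) \<oplus> snd (\<phi> (K, R)) i" if "i < v" for K R i
      using that by (cases "a i"; cases "a' i") (simp_all add: \<phi>_def d_def bxor_def ENC_def)
    ultimately have view: "final_view v ?\<pi> a K R KH =
        final_view v ?\<pi> a' (fst (\<phi> (K, R))) (snd (\<phi> (K, R))) KH" for K R
      unfolding final_view_and_protocol[OF pr] by (simp cong: map_cong)
    show ?thesis
      unfolding KH by (rule view_distribution_eqI[OF _ _ _ view])
        (auto simp: num \<phi>_def d_def bxor_def)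
  next
    case EVH
    \<comment> \<open>Keeping the ciphertexts of EVH fixed forces \<open>K\<close> to shift by
      \<open>d\<close>. This changes the unmasked correction of a pair by \<open>c\<close>, which
      its pair key, unknown to EVH, absorbs.\<close>
    define c where "c R l \<longleftrightarrow> v \<le> l \<and> l < v + t \<and>
        (case pr (l - v) of (i, j) \<Rightarrow> (R i \<and> d j) \<oplus> (R j \<and> d i))" for R l
    define \<phi> :: "(nat \<Rightarrow> bool) \<times> (nat \<Rightarrow> bool) \<Rightarrow> (nat \<Rightarrow> bool) \<times> (nat \<Rightarrow> bool)"
      where "\<phi> = (\<lambda>(K, R). (\<lambda>i. K i \<oplus> d i, \<lambda>l. R l \<oplus> c R l))"
    have c_low: "\<not> c R l" if "l < v" for R l
      using that by (simp add: c_def)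
    \<comment> \<open>\<open>c R\<close> reads \<open>R\<close> only below \<open>v\<close>, where
      the shift by \<open>c R\<close> vanishes; hence \<open>\<phi>\<close> is an
      involution.\<close>
    have c_cong: "c (\<lambda>l. R l \<oplus> c R l) l = c R l" for R l
    proof (cases "v \<le> l \<and> l < v + t")
      case True
      then have "pr (l - v) \<in> {..<v} \<times> {..<v}"
        by (intro subsetD[OF pr] imageI) auto
      then have "fst (pr (l - v)) < v" "snd (pr (l - v)) < v"
        by auto
      then show ?thesis
        by (simp add: c_def[of _ l] c_low bxor_def split_beta)
    next
      case False
      then show ?thesis by (auto simp: c_def[of _ l])
    qed
    have correction: "(case pr n of (i, j) \<Rightarrow> (R i \<and> K j) \<oplus> (R j \<and> K i) \<oplus> R (v + n)) =
        (case pr n of (i, j) \<Rightarrow> (snd (\<phi> (K, R)) i \<and> fst (\<phi> (K, R)) j) \<oplus>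
          (snd (\<phi> (K, R)) j \<and> fst (\<phi> (K, R)) i) \<oplus> snd (\<phi> (K, R)) (v + n))"
      if n: "n < t" for n K R
    proof -
      obtain i j where ij: "pr n = (i, j)"
        by (cases "pr n")
      have "pr n \<in> {..<v} \<times> {..<v}"
        using pr n by (simp add: image_subset_iff)
      then have "i < v" "j < v"
        by (simp_all add: ij)
      then have "\<not> c R i" "\<not> c R j"
        by (simp_all add: c_low)
      moreover have "c R (v + n) \<longleftrightarrow> (R i \<and> d j) \<oplus> (R j \<and> d i)"
        using n by (simp add: c_def ij)
      ultimately show ?thesis
        by (cases "R i"; cases "R j"; cases "d i"; cases "d j"; cases "K i"; cases "K j")
          (auto simp: ij \<phi>_def bxor_def)
    qed
    have init: "initial_view v ?\<pi> a K R EVH =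
        initial_view v ?\<pi> a' (fst (\<phi> (K, R))) (snd (\<phi> (K, R))) EVH" for K R
      by (auto simp: \<phi>_def c_low d_def bxor_def ENC_def initial_view_def and_protocol_def
          fun_eq_iff)
    have view: "final_view v ?\<pi> a K R EVH =
        final_view v ?\<pi> a' (fst (\<phi> (K, R))) (snd (\<phi> (K, R))) EVH" for K R
      unfolding final_view_and_protocol[OF pr]
      by (intro arg_cong2[where f = "\<lambda>w xs. w\<lparr>received := xs\<rparr>", OF init] map_cong refl
          correction) simp
    have "\<phi> (\<phi> x) = x" for x
      by (simp add: \<phi>_def c_cong split_beta) (auto simp: bxor_def prod_eq_iff fun_eq_iff)
    then show ?thesis
      unfolding EVH by (rule view_distribution_eqI[OF _ _ _ view])
        (simp_all add: num \<phi>_def d_def c_def bxor_def)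
  next
    case Helper
    \<comment> \<open>The helper holds only keys and receives nothing, so the keys need no
      change.\<close>
    have "initial_view v ?\<pi> a K R Helper = initial_view v ?\<pi> a' K R Helper" for K R
      by (simp add: initial_view_def)
    then show ?thesis
      unfolding Helper view_distribution_def final_view_and_protocol[OF pr] by simp
  qed
qed

section \<open>Instantiation at an enumeration of the pairs\<close>

theorem theorem7:
  fixes v t :: nat and P :: "(nat \<times> nat) set"
  assumes "real t \<in> {real v .. (real v)\<^sup>2 / 2}"
    and "P \<subseteq> {..<v} \<times> {..<v}" and "card P = t"
  shows "\<exists>\<pi>. valid_protocol \<pi> \<and> computes_ands v P \<pi> \<and> perfectly_secure v \<pi> \<and>
           transmitted_bits \<pi> \<le> 4 * v + t \<and>
           real (transmitted_bits \<pi>) / real t \<le> 1 + 4 * (real v / real t)"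
proof -
  have "finite P"
    using assms(2) by (rule finite_subset) auto
  then obtain pr where bij: "bij_betw pr {0..<t} P"
    using ex_bij_betw_nat_finite assms(3) by blast
  define idx where "idx = inv_into {0..<t} pr"
  have pr: "pr ` {..<t} \<subseteq> {..<v} \<times> {..<v}"
    using bij_betw_imp_surj_on[OF bij] assms(2) by (simp add: lessThan_atLeast0)
  have idx: "idx p < t \<and> pr (idx p) = p" if "p \<in> P" for p
    using that bij_betw_apply[OF bij_betw_inv_into[OF bij], of p]
      bij_betw_inv_into_right[OF bij, of p] by (simp add: idx_def)
  \<comment> \<open>For \<open>t = 0\<close> both quotients are \<open>0\<close> by the convention
    for division; otherwise the left side is \<open>1 + v / t\<close>.\<close>
  have "real (v + t) / real t \<le> 1 + 4 * (real v / real t)"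
    by (cases "t = 0") (simp_all add: field_simps)
  then show ?thesis
    using valid_and_protocol computes_ands_and_protocol[OF pr idx]
      perfectly_secure_and_protocol[OF pr]
    by (intro exI[of _ "and_protocol v t pr idx"])
      (simp add: transmitted_bits_and_protocol)
qed

end
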